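(* There exists a finite simple planar graph that contains no cycle of length four and no cycle of length five, and that is not $3$-colorable (i.e., there is no map assigning to each vertex one of three colors such that adjacent vertices receive different colors).
   Context: A cycle of length $k$ in a graph is a subgraph consisting of $k$ distinct vertices $v_1,\ldots,v_k$ and the $k$ edges $v_1v_2, v_2v_3,\ldots,v_{k-1}v_k,v_kv_1$; the cycles need not be induced. *)

theory Defs
  imports "HOL-Analysis.Analysis"
begin

definition finite_simple_graph :: "'a set \<Rightarrow> ('a \<Rightarrow> 'a \<Rightarrow> bool) \<Rightarrow> bool" where
  "finite_simple_graph V E \<longleftrightarrow> finite V \<and>
     (\<forall>u v. E u v \<longrightarrow> u \<in> V \<and> v \<in> V) \<and>
     (\<forall>u v. E u v \<longrightarrow> E v u) \<and> (\<forall>v. \<not> E v v)"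

definition has_cycle_of_length :: "'a set \<Rightarrow> ('a \<Rightarrow> 'a \<Rightarrow> bool) \<Rightarrow> nat \<Rightarrow> bool" where
  "has_cycle_of_length V E k \<longleftrightarrow> 3 \<le> k \<and>
     (\<exists>vs. length vs = k \<and> distinct vs \<and> set vs \<subseteq> V \<and>
        (\<forall>i<k. E (vs ! i) (vs ! ((i + 1) mod k))))"

definition colorable :: "'a set \<Rightarrow> ('a \<Rightarrow> 'a \<Rightarrow> bool) \<Rightarrow> nat \<Rightarrow> bool" where
  "colorable V E n \<longleftrightarrow> (\<exists>c :: 'a \<Rightarrow> nat. (\<forall>v\<in>V. c v < n) \<and>
      (\<forall>u\<in>V. \<forall>v\<in>V. E u v \<longrightarrow> c u \<noteq> c v))"

definition planar :: "'a set \<Rightarrow> ('a \<Rightarrow> 'a \<Rightarrow> bool) \<Rightarrow> bool" where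
  "planar V E \<longleftrightarrow> (\<exists>(p :: 'a \<Rightarrow> complex) (g :: 'a \<Rightarrow> 'a \<Rightarrow> real \<Rightarrow> complex).
     inj_on p V \<and>
     (\<forall>u v. E u v \<longrightarrow> arc (g u v) \<and> pathstart (g u v) = p u \<and> pathfinish (g u v) = p v \<and>
              path_image (g u v) \<inter> p ` V \<subseteq> {p u, p v}) \<and>
     (\<forall>u v x y. E u v \<and> E x y \<and> {u, v} \<noteq> {x, y} \<longrightarrow>
              path_image (g u v) \<inter> path_image (g x y) \<subseteq> p ` ({u, v} \<inter> {x, y})))"

end

theory Submission
  imports Defs "HOL-Library.Code_Binary_Nat"
begin

text \<open>
  The graph is built from a gadget: a planar graph with 29 vertices, without cycles of length four
  or five, in which two vertices at distance three receive different colours in every 3-colouring.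
  Joining the corners of a triangle to a new vertex, the hub, by three gadgets imitates \<open>K\<^sub>4\<close>: the
  colour of the hub differs from the three colours on the triangle. Two copies of the gadget share
  only the hub, and a cycle through two copies has length at least seven, so no
  cycle of length four or five arises. The gadget was found by a computer search over small
  plane graphs with few boundary vertices, and planarity is certified by a straight-line drawing
  with integer coordinates.
\<close>

subsection \<open>The graph\<close>

text \<open>
  The entry at index \<open>i\<close> lists the neighbours of \<open>i\<close> that are smaller than \<open>i\<close>. The vertices 0 and 1
  are the ones that must be coloured differently; the others are numbered such that greedy
  backtracking refutes a colouring with equal colours on 0 and 1 after few steps.
\<close>
definition gadget :: "nat list list" where
  "gadget = [[], [], [1], [1, 2], [0, 3], [0, 4], [3, 4], [0], [1, 7], [0, 7], [1, 8], [7, 8], [2],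
     [2, 12], [13], [6, 14], [14, 15], [5, 16], [12, 17], [12, 18], [0, 19], [19, 20], [10, 21],
     [21, 22], [9, 23], [10, 22], [24], [25, 26], [11, 26, 27]]"

definition gadget_edges :: "(nat \<times> nat) list" where
  "gadget_edges = concat (map (\<lambda>i. map (\<lambda>j. (j, i)) (gadget ! i)) [0..<29])"

text \<open>Vertex 0 is the hub shared by all copies; the other vertices of copy \<open>k\<close>
  fill the block from \<open>28 * k + 1\<close> to \<open>28 * k + 28\<close>. Hence vertex 1 of the
  three copies gives the triangle corners 1, 29 and 57.\<close>

definition place :: "nat \<Rightarrow> nat \<Rightarrow> nat" where
  "place k i = (if i = 0 then 0 else 28 * k + i)"

definition edges :: "(nat \<times> nat) list" where
  "edges = [(1, 29), (29, 57), (1, 57)] @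
     concat (map (\<lambda>k. map (map_prod (place k) (place k)) gadget_edges) [0, 1, 2])"

definition adjacent :: "nat \<Rightarrow> nat \<Rightarrow> bool" where
  "adjacent u v \<longleftrightarrow> (u, v) \<in> set edges \<or> (v, u) \<in> set edges"

lemma edges_wf: "\<forall>(u, v) \<in> set edges. u < 85 \<and> v < 85 \<and> u \<noteq> v"
  by code_simp

lemma adjacent_sym: "adjacent u v \<Longrightarrow> adjacent v u"
  by (auto simp: adjacent_def)

lemma adjacent_wf:
  assumes "adjacent u v"
  shows "u < 85" "v < 85" "u \<noteq> v"
  using assms edges_wf by (auto simp: adjacent_def)

lemma place_gadget_edge:
  assumes "k < 3" "i < 29" "j \<in> set (gadget ! i)"
  shows "adjacent (place k j) (place k i)"
proof -
  have "(j, i) \<in> set gadget_edges"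
    using assms by (auto simp: gadget_edges_def)
  moreover have "k \<in> {0, 1, 2}"
    using assms(1) by auto
  ultimately have "(place k j, place k i) \<in> set edges"
    unfolding edges_def by force
  then show ?thesis
    by (simp add: adjacent_def)
qed

subsection \<open>Colourings\<close>

text \<open>Backtracking in executable form: \<open>cs\<close> holds the colours chosen so far, and
  each remaining list names the earlier neighbours of the next vertex.\<close>

fun extendable :: "nat list list \<Rightarrow> nat list \<Rightarrow> bool" where
  "extendable [] cs \<longleftrightarrow> True"
| "extendable (N # Ns) cs \<longleftrightarrow>
     list_ex (\<lambda>x. x \<notin> set (map ((!) cs) N) \<and> extendable Ns (cs @ [x])) [0, 1, 2]"

text \<open>Following the choices of \<open>c\<close>, the search never meets a conflict. The
  condition \<open>j < n + i\<close> keeps every lookup inside the prefix already coloured.\<close>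

lemma extendable_if_coloring:
  assumes "\<And>i. i < length Ns \<Longrightarrow> c (n + i) < 3"
    and "\<And>i j. i < length Ns \<Longrightarrow> j \<in> set (Ns ! i) \<Longrightarrow> j < n + i \<and> c j \<noteq> c (n + i)"
  shows "extendable Ns (map c [0..<n])"
  using assms
proof (induction Ns arbitrary: n)
  case Nil
  then show ?case by simp
next
  case (Cons N Ns)
  have "extendable Ns (map c [0..<Suc n])"
  proof (rule Cons.IH)
    fix i assume "i < length Ns"
    then show "c (Suc n + i) < 3"
      using Cons.prems(1)[of "Suc i"] by simp
  next
    fix i j assume "i < length Ns" "j \<in> set (Ns ! i)"
    then show "j < Suc n + i \<and> c j \<noteq> c (Suc n + i)"
      using Cons.prems(2)[of "Suc i" j] by simp
  qed
  moreover have "c n \<notin> set (map ((!) (map c [0..<n])) N)"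
    using Cons.prems(2)[of 0] by fastforce
  moreover have "c n \<in> {0, 1, 2}"
    using Cons.prems(1)[of 0] by auto
  ultimately show ?case
    by (auto simp: list_ex_iff simp del: upt_Suc simp add: upt_Suc_append)
qed

lemma gadget_not_extendable: "\<forall>x \<in> {0, 1, 2}. \<not> extendable (drop 2 gadget) [x, x]"
  by code_simp

lemma gadget_smaller: "\<forall>i \<in> set [0..<29]. \<forall>j \<in> set (gadget ! i). j < i"
  by code_simp

lemma gadget_ends_differ:
  fixes c :: "nat \<Rightarrow> nat"
  assumes "\<And>i. i < 29 \<Longrightarrow> c i < 3"
    and "\<And>i j. i < 29 \<Longrightarrow> j \<in> set (gadget ! i) \<Longrightarrow> c j \<noteq> c i"
  shows "c 0 \<noteq> c 1"
proof
  assume eq: "c 0 = c 1"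
  have len: "length gadget = 29"
    by (simp add: gadget_def)
  \<comment> \<open>Vertices 0 and 1 form the precoloured prefix, so entry \<open>i\<close> of
    \<open>drop 2 gadget\<close> belongs to vertex \<open>2 + i\<close>.\<close>
  have "extendable (drop 2 gadget) (map c [0..<2])"
    by (rule extendable_if_coloring) (use assms gadget_smaller in \<open>auto simp: len\<close>)
  then have "extendable (drop 2 gadget) [c 1, c 1]"
    by (simp add: numeral_2_eq_2 eq)
  moreover have "c 1 \<in> {0, 1, 2}"
    using assms(1)[of 1] by auto
  ultimately show False
    using gadget_not_extendable by blast
qed

lemma not_3_colorable: "\<not> colorable {..<85} adjacent 3"
proof
  assume "colorable {..<85} adjacent 3"
  then obtain c :: "nat \<Rightarrow> nat" where bound: "\<And>v. v < 85 \<Longrightarrow> c v < 3"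
    and proper: "\<And>u v. adjacent u v \<Longrightarrow> c u \<noteq> c v"
    unfolding colorable_def using adjacent_wf by blast
  have "c 0 \<noteq> c (28 * k + 1)" if "k < 3" for k
  proof -
    have "c (place k 0) \<noteq> c (place k 1)"
    proof (rule gadget_ends_differ)
      fix i :: nat assume "i < 29"
      then show "c (place k i) < 3"
        using that by (intro bound) (simp add: place_def)
    next
      fix i j assume "i < 29" "j \<in> set (gadget ! i)"
      then show "c (place k j) \<noteq> c (place k i)"
        using that by (intro proper place_gadget_edge)
    qed
    then show ?thesis
      by (simp add: place_def)
  qed
  from this[of 0] this[of 1] this[of 2] have "c 0 \<noteq> c 1" "c 0 \<noteq> c 29" "c 0 \<noteq> c 57"
    by simp_all
  moreover have "c 1 \<noteq> c 29" "c 29 \<noteq> c 57" "c 1 \<noteq> c 57"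
    by (rule proper; simp add: adjacent_def edges_def)+
  moreover have "c 0 < 3" "c 1 < 3" "c 29 < 3" "c 57 < 3"
    by (simp_all add: bound)
  ultimately show False
    by linarith
qed

subsection \<open>Short cycles\<close>

definition neighbours :: "(nat \<times> nat) list \<Rightarrow> nat \<Rightarrow> nat list" where
  "neighbours es u = map snd (filter (\<lambda>e. fst e = u) es) @ map fst (filter (\<lambda>e. snd e = u) es)"

lemma in_neighbours_iff: "v \<in> set (neighbours edges u) \<longleftrightarrow> adjacent u v"
  by (force simp: neighbours_def adjacent_def)

text \<open>\<open>A\<close> is meant to list the neighbours of \<open>v\<close> and
  \<open>B\<close> those of \<open>u\<close>, each with its own neighbours. A path
  \<open>x v u y\<close> is closed to a 4-cycle if \<open>z = x\<close>, and to a 5-cycle by a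
  further common neighbour \<open>z\<close> of \<open>x\<close> and \<open>y\<close>.\<close>

definition no_short_cycle_through ::
  "nat \<Rightarrow> nat \<Rightarrow> (nat \<times> nat list) list \<Rightarrow> (nat \<times> nat list) list \<Rightarrow> bool" where
  "no_short_cycle_through u v A B \<longleftrightarrow>
     list_all (\<lambda>(x, X). list_all (\<lambda>(y, Y). x = u \<or> y = v \<or> x = y \<or>
       list_all (\<lambda>z. z = u \<or> z \<noteq> x \<and> (z = v \<or> z \<notin> set X)) Y) B) A"

definition on_no_short_cycle :: "nat list list \<Rightarrow> nat \<times> nat \<Rightarrow> bool" where
  "on_no_short_cycle N e = (case e of (u, v) \<Rightarrow> no_short_cycle_through u v
     (map (\<lambda>x. (x, N ! x)) (N ! v)) (map (\<lambda>y. (y, N ! y)) (N ! u)))"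

lemma no_short_cycles_check: "list_all (on_no_short_cycle (map (neighbours edges) [0..<85])) edges"
  by code_simp

lemma edge_on_no_short_cycle:
  assumes "adjacent u v" "adjacent v x" "adjacent u y" "x \<noteq> u" "y \<noteq> v" "x \<noteq> y"
  shows "\<not> adjacent x y" and "adjacent x z \<Longrightarrow> adjacent y z \<Longrightarrow> z = u \<or> z = v"
proof -
  have *: "\<not> adjacent x y \<and> (\<forall>z. adjacent x z \<longrightarrow> adjacent y z \<longrightarrow> z = u \<or> z = v)"
    if e: "(u, v) \<in> set edges" and a: "adjacent v x" "adjacent u y" "x \<noteq> u" "y \<noteq> v" "x \<noteq> y"
    for u v x y
  proof -
    let ?N = "map (neighbours edges) [0..<85]"
    have "on_no_short_cycle ?N (u, v)"
      using e no_short_cycles_check by (auto simp: list_all_iff)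
    then have "\<forall>x \<in> set (?N ! v). \<forall>y \<in> set (?N ! u). x = u \<or> y = v \<or> x = y \<or>
        (\<forall>z \<in> set (?N ! y). z = u \<or> z \<noteq> x \<and> (z = v \<or> z \<notin> set (?N ! x)))"
      by (simp only: on_no_short_cycle_def no_short_cycle_through_def list_all_iff case_prod_conv
          set_map ball_simps)
    moreover have N: "set (?N ! w) = Collect (adjacent w)" if "w < 85" for w
      using that by (auto simp: in_neighbours_iff)
    moreover have w: "u < 85" "v < 85" "x < 85" "y < 85"
      using e a adjacent_wf by (auto simp: adjacent_def)
    ultimately have "\<forall>z \<in> set (?N ! y). z = u \<or> z \<noteq> x \<and> (z = v \<or> z \<notin> set (?N ! x))"
      using a by blast
    then show ?thesis
      unfolding N[OF w(3)] N[OF w(4)] using adjacent_sym \<open>x \<noteq> u\<close> by blast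
  qed
  from assms(1) have "(u, v) \<in> set edges \<or> (v, u) \<in> set edges"
    by (simp add: adjacent_def)
  \<comment> \<open>Each edge is checked in one orientation only; reversing the path
    \<open>x v u y\<close> exchanges \<open>u\<close> with \<open>v\<close> and \<open>x\<close>
    with \<open>y\<close> and covers the other.\<close>
  then have "\<not> adjacent x y \<and> (\<forall>z. adjacent x z \<longrightarrow> adjacent y z \<longrightarrow> z = u \<or> z = v)"
    using *[of u v x y] *[of v u y x] assms adjacent_sym by blast
  then show "\<not> adjacent x y" and "adjacent x z \<Longrightarrow> adjacent y z \<Longrightarrow> z = u \<or> z = v"
    by blast+
qed

lemma no_4_cycle: "\<not> has_cycle_of_length V adjacent 4"
proof
  assume "has_cycle_of_length V adjacent 4"
  then obtain vs where vs: "length vs = 4" "distinct vs"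
    "\<forall>i<4. adjacent (vs ! i) (vs ! ((i + 1) mod 4))"
    by (auto simp: has_cycle_of_length_def)
  from vs(1) obtain a b c d where "vs = [a, b, c, d]"
    by (auto simp: numeral_eq_Suc length_Suc_conv)
  with vs have "distinct [a, b, c, d]" "adjacent a b" "adjacent b c" "adjacent c d" "adjacent d a"
    using vs(3)[rule_format, of 0] vs(3)[rule_format, of 1] vs(3)[rule_format, of 2]
      vs(3)[rule_format, of 3]
    by simp_all
  then show False
    \<comment> \<open>The path \<open>d a b c\<close> around the edge from \<open>a\<close> to
      \<open>b\<close> would be closed by the edge from \<open>c\<close> to
      \<open>d\<close>.\<close>
    using edge_on_no_short_cycle(1)[of a b c d] adjacent_sym by auto
qed

lemma no_5_cycle: "\<not> has_cycle_of_length V adjacent 5"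
proof
  assume "has_cycle_of_length V adjacent 5"
  then obtain vs where vs: "length vs = 5" "distinct vs"
    "\<forall>i<5. adjacent (vs ! i) (vs ! ((i + 1) mod 5))"
    by (auto simp: has_cycle_of_length_def)
  from vs(1) obtain a b c d e where "vs = [a, b, c, d, e]"
    by (auto simp: numeral_eq_Suc length_Suc_conv)
  with vs have "distinct [a, b, c, d, e]"
    "adjacent a b" "adjacent b c" "adjacent c d" "adjacent d e" "adjacent e a"
    using vs(3)[rule_format, of 0] vs(3)[rule_format, of 1] vs(3)[rule_format, of 2]
      vs(3)[rule_format, of 3] vs(3)[rule_format, of 4]
    by simp_all
  then show False
    \<comment> \<open>Here \<open>d\<close> is the forbidden common neighbour of the ends of the
      path \<open>e a b c\<close>.\<close>
    using edge_on_no_short_cycle(2)[of a b c e d] adjacent_sym by auto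
qed

subsection \<open>Planarity\<close>

text \<open>Without isolated vertices, the condition on vertices lying on arcs reduces to the one on
  pairs of arcs: a vertex on a foreign segment is also an end point of a segment of its own.\<close>

lemma planar_if_straight_line_drawing:
  fixes p :: "'a \<Rightarrow> complex"
  assumes inj: "inj_on p V"
    and E: "\<And>u v. E u v \<Longrightarrow> u \<in> V \<and> v \<in> V \<and> u \<noteq> v"
    and not_isolated: "\<And>v. v \<in> V \<Longrightarrow> \<exists>u. E v u"
    and crossing_free: "\<And>u v x y. E u v \<Longrightarrow> E x y \<Longrightarrow> {u, v} \<noteq> {x, y} \<Longrightarrow>
      closed_segment (p u) (p v) \<inter> closed_segment (p x) (p y) \<subseteq> p ` ({u, v} \<inter> {x, y})"
  shows "planar V E"
proof -
  have "closed_segment (p u) (p v) \<inter> p ` V \<subseteq> {p u, p v}" if uv: "E u v" for u v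
  proof -
    have "x \<in> {u, v}" if x: "x \<in> V" "p x \<in> closed_segment (p u) (p v)" for x
    proof (rule ccontr)
      assume "x \<notin> {u, v}"
      obtain y where xy: "E x y"
        using not_isolated x(1) by blast
      with x \<open>x \<notin> {u, v}\<close> have "p x \<in> p ` ({u, v} \<inter> {x, y})"
        using crossing_free[OF uv xy] by auto
      with x uv xy inj E \<open>x \<notin> {u, v}\<close> show False
        by (auto simp: inj_on_def)
    qed
    then show ?thesis by blast
  qed
  moreover have "p u \<noteq> p v" if "E u v" for u v
    using E[OF that] inj by (auto dest: inj_onD)
  ultimately show ?thesis
    unfolding planar_def
    by (intro exI[of _ p] exI[of _ "\<lambda>u v. linepath (p u) (p v)"])
      (auto simp: inj intro!: arc_linepath dest: crossing_free[THEN subsetD, OF _ _ _ IntI])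
qed

text \<open>Twice the signed area of the triangle \<open>p q r\<close>; its sign tells on which side
  of the line through \<open>p\<close> and \<open>q\<close> the point \<open>r\<close> lies.\<close>

definition orientation :: "complex \<Rightarrow> complex \<Rightarrow> complex \<Rightarrow> real" where
  "orientation p q r = (Re q - Re p) * (Im r - Im p) - (Im q - Im p) * (Re r - Re p)"

text \<open>The orientation is affine in its third argument and zero at \<open>z\<close>, and a
  convex combination of two numbers of the same weak sign is zero only if both of its terms
  are.\<close>

lemma segment_meets_one_side:
  assumes "z \<in> closed_segment p q" "z \<in> closed_segment r s"
    and "orientation p q r * orientation p q s \<ge> 0"
    and "orientation p q r \<noteq> 0 \<or> orientation p q s \<noteq> 0"
  shows "z = r \<and> orientation p q r = 0 \<or> z = s \<and> orientation p q s = 0"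
proof -
  let ?A = "orientation p q r" and ?B = "orientation p q s"
  obtain a where a: "z = (1 - a) *\<^sub>R p + a *\<^sub>R q"
    using assms(1) by (auto simp: in_segment)
  obtain t where t: "z = (1 - t) *\<^sub>R r + t *\<^sub>R s" "0 \<le> t" "t \<le> 1"
    using assms(2) by (auto simp: in_segment)
  have "orientation p q z = 0"
    by (simp add: a orientation_def algebra_simps)
  moreover have "orientation p q z = (1 - t) * ?A + t * ?B"
    by (simp add: t orientation_def algebra_simps)
  ultimately have 0: "(1 - t) * ?A + t * ?B = 0"
    by simp
  \<comment> \<open>The terms are negatives of each other with a nonnegative product, so minus a
    square is nonnegative.\<close>
  have "(1 - t) * ?A = 0 \<and> t * ?B = 0"
  proof -
    have "0 \<le> ((1 - t) * ?A) * (t * ?B)"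
      using t assms(3) by (metis mult.assoc mult.left_commute mult_nonneg_nonneg diff_ge_0_iff_ge)
    moreover have "t * ?B = - ((1 - t) * ?A)"
      using 0 by linarith
    ultimately have "((1 - t) * ?A) * ((1 - t) * ?A) \<le> 0"
      by simp
    then have "(1 - t) * ?A = 0"
      by (metis mult_eq_0_iff order_antisym zero_le_square)
    with 0 show ?thesis by simp
  qed
  with t assms(4) show ?thesis
    by auto
qed

definition points :: "(int \<times> int) list" where
  "points = [(0, 0), (25, 0), (14, 2), (11, 4), (5, 6), (4, 3), (8, 4), (8, -5), (12, -4), (7, -3),
     (14, -3), (10, -4), (11, 0), (10, 2), (9, 3), (8, 3), (10, 1), (6, 2), (9, 1), (8, 1), (4, -1),
     (7, 0), (11, -1), (7, -1), (8, -2), (12, -2), (10, -3), (11, -2), (11, -3)]"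

text \<open>
  The hub is the origin, and the second and third copy of the gadget arise from the first one by
  multiplication with \<open>-1 + 2\<i>\<close> and \<open>-1 - 2\<i>\<close>.
\<close>
definition coords :: "nat \<Rightarrow> int \<times> int" where
  "coords v = (let (x, y) = points ! (if v = 0 then 0 else Suc ((v - 1) mod 28))
     in [(x, y), (- x - 2 * y, 2 * x - y), (- x + 2 * y, - 2 * x - y)] ! ((v - 1) div 28))"

definition to_complex :: "int \<times> int \<Rightarrow> complex" where
  "to_complex r = Complex (of_int (fst r)) (of_int (snd r))"

text \<open>Integer arithmetic makes the drawing checkable by evaluation.\<close>

fun orientation_int :: "int \<times> int \<Rightarrow> int \<times> int \<Rightarrow> int \<times> int \<Rightarrow> int" where
  "orientation_int (a, b) (c, d) (e, f) = (c - a) * (f - b) - (d - b) * (e - a)"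

lemma orientation_to_complex:
  "orientation (to_complex p) (to_complex q) (to_complex r) = of_int (orientation_int p q r)"
  by (cases p; cases q; cases r) (simp add: orientation_def to_complex_def)

lemma inj_to_complex: "inj to_complex"
  by (auto simp: inj_def to_complex_def prod_eq_iff)

text \<open>End points carry their vertex, so that common end points are recognised by name and
  coordinates need not be recomputed for each pair of edges.\<close>

type_synonym segment = "(nat \<times> int \<times> int) \<times> (nat \<times> int \<times> int)"

text \<open>
  The end points of the second segment lie weakly on the same side of the line through the first
  one; an end point on that line has to be a common vertex.
\<close>
fun one_side :: "segment \<Rightarrow> segment \<Rightarrow> bool" where
  "one_side ((u, p), (v, q)) ((x, r), (y, s)) \<longleftrightarrow>
     (let a = orientation_int p q r; b = orientation_int p q s in
       a * b > 0 \<or> a * b = 0 \<and> (a = 0 \<longrightarrow> x = u \<or> x = v) \<and> (b = 0 \<longrightarrow> y = u \<or> y = v))"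

definition segment_of :: "nat \<times> nat \<Rightarrow> segment" where
  "segment_of e = (case e of (u, v) \<Rightarrow> ((u, coords u), (v, coords v)))"

text \<open>One of the two lines suffices: even if two segments are disjoint, the line through one
  of them may cut the other.\<close>

definition separated :: "segment \<Rightarrow> segment \<Rightarrow> bool" where
  "separated e f \<longleftrightarrow> one_side e f \<or> one_side f e"

text \<open>No order is meant: \<open>sorted_wrt\<close> compares each edge with all later ones,
  hence every pair of edges once.\<close>

lemma separated_check: "sorted_wrt separated (map segment_of edges)"
  by code_simp

lemma coords_distinct: "distinct (map coords [0..<85])"
  by code_simp

lemma no_isolated_vertex: "list_all (\<lambda>ns. ns \<noteq> []) (map (neighbours edges) [0..<85])"
  by code_simp

lemma one_side_segments_meet:
  fixes u v x y :: nat
  defines "p \<equiv> to_complex \<circ> coords"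
  assumes "one_side (segment_of (u, v)) (segment_of (x, y))" "{u, v} \<noteq> {x, y}" "x \<noteq> y"
  shows "closed_segment (p u) (p v) \<inter> closed_segment (p x) (p y) \<subseteq> p ` ({u, v} \<inter> {x, y})"
proof safe
  fix z assume z: "z \<in> closed_segment (p u) (p v)" "z \<in> closed_segment (p x) (p y)"
  define a b where "a = orientation_int (coords u) (coords v) (coords x)"
    and "b = orientation_int (coords u) (coords v) (coords y)"
  have ab: "orientation (p u) (p v) (p x) = of_int a" "orientation (p u) (p v) (p y) = of_int b"
    by (simp_all add: p_def a_def b_def orientation_to_complex)
  have *: "a * b > 0 \<or> a * b = 0 \<and> (a = 0 \<longrightarrow> x = u \<or> x = v) \<and> (b = 0 \<longrightarrow> y = u \<or> y = v)"
    using assms(2) by (simp add: segment_of_def a_def b_def Let_def)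
  \<comment> \<open>If both were zero, \<open>x\<close> and \<open>y\<close> would be two distinct
    elements of \<open>{u, v}\<close>, so the edges would coincide.\<close>
  then have "a * b \<ge> 0" "a \<noteq> 0 \<or> b \<noteq> 0"
    using assms(3,4) by auto
  then have "z = p x \<and> a = 0 \<or> z = p y \<and> b = 0"
    using segment_meets_one_side[OF z]
    by (simp add: ab flip: of_int_mult)
  with * show "z \<in> p ` ({u, v} \<inter> {x, y})"
    by auto
qed

lemma sorted_wrt_symp_distinct:
  assumes "sorted_wrt R xs" "symp R" "x \<in> set xs" "y \<in> set xs" "x \<noteq> y"
  shows "R x y"
proof -
  obtain i j where "i < length xs" "j < length xs" "x = xs ! i" "y = xs ! j"
    using assms(3,4) by (auto simp: in_set_conv_nth)
  with assms show ?thesis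
    by (cases i j rule: linorder_cases) (auto simp: sorted_wrt_iff_nth_less dest: sympD)
qed

lemma planar_graph: "planar {..<85} adjacent"
proof (rule planar_if_straight_line_drawing)
  let ?p = "to_complex \<circ> coords"
  show "inj_on ?p {..<85}"
    using coords_distinct inj_on_subset[OF inj_to_complex]
    by (intro comp_inj_on) (auto simp: distinct_map atLeast0LessThan)
  show "\<exists>u. adjacent v u" if "v \<in> {..<85}" for v
  proof -
    have "neighbours edges v \<noteq> []"
      using that no_isolated_vertex by (auto simp: list_all_iff)
    then show ?thesis
      using in_neighbours_iff hd_in_set by blast
  qed
  have *: "closed_segment (?p u) (?p v) \<inter> closed_segment (?p x) (?p y) \<subseteq> ?p ` ({u, v} \<inter> {x, y})"
    if "(u, v) \<in> set edges" "(x, y) \<in> set edges" "{u, v} \<noteq> {x, y}" for u v x y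
  proof -
    have "separated (segment_of (u, v)) (segment_of (x, y))"
    proof (rule sorted_wrt_symp_distinct[OF separated_check])
      show "symp separated"
        by (auto simp: symp_def separated_def)
    qed (use that in \<open>auto simp: segment_of_def\<close>)
    moreover have "u \<noteq> v" "x \<noteq> y"
      using that edges_wf by auto
    ultimately show ?thesis
      using one_side_segments_meet[of u v x y] one_side_segments_meet[of x y u v] that(3)
      by (auto simp: separated_def Int_commute)
  qed
  show "closed_segment (?p u) (?p v) \<inter> closed_segment (?p x) (?p y) \<subseteq> ?p ` ({u, v} \<inter> {x, y})"
    if "adjacent u v" "adjacent x y" "{u, v} \<noteq> {x, y}" for u v x y
    \<comment> \<open>Either edge may be listed in either orientation; neither the segments nor the
      sets of end points depend on it.\<close>
    using that(1,2) unfolding adjacent_def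
    by (elim disjE; insert that(3) *[of u v x y] *[of v u x y] *[of u v y x] *[of v u y x];
      simp add: closed_segment_commute insert_commute)
qed (auto dest: adjacent_wf)

theorem theorem5:
  shows "\<exists>(V :: nat set) E. finite_simple_graph V E \<and> planar V E \<and>
           \<not> has_cycle_of_length V E 4 \<and> \<not> has_cycle_of_length V E 5 \<and>
           \<not> colorable V E 3"
proof (intro exI conjI)
  show "finite_simple_graph {..<85} adjacent"
    unfolding finite_simple_graph_def using adjacent_wf adjacent_sym by blast
qed (fact planar_graph no_4_cycle no_5_cycle not_3_colorable)+

end
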